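(* Let $\mathcal H$ be a set of formulas and $Q$ a formula with $\mathcal H\not\vdash Q$ in QPL, and let $S=\mathcal H\cup\{Q\}$. Then there exist a standard structure $M$ for $S$ and an override function $O$ for $S$ such that $M\models_O Y$ for every $Y\in\mathcal H$ but $M\not\models_O Q$.
   Context: Language: first-order, no equality, no function symbols of positive arity; terms are variables and constants; atomic formulas $\top,\bot,R(t_1,\dots,t_j)$; formulas built by $\land,\lor,\to,\forall x,\exists x$; $A(t)$ is substitution of substitutable $t$ for free $x$. QPL is the Hilbert-style calculus with rules (premises / conclusion): axioms $\top$ and $A\to A$; $A,B/A\land B$; $A\land B/A$, $A\land B/B$; $A/A\lor B$, $B/A\lor B$; $A\lor A/A$; $B/A\to B$; $A,A\to B/B$; $\bot/A$; $A/\forall xA$ ($x$ not free in $A$); $\forall xA(x)/A(t)$; $A(t)/\exists xA(x)$; $\exists xA/A$ ($x$ not free in $A$). $\mathcal H\vdash Q$ means there is a finite derivation tree of $Q$ whose leaves are axioms or members of $\mathcal H$. Parameters of a formula: constants occurring and variables free in it. Fix a constant; $\mathrm{Pars}^*(S)$ is the set of parameters of formulas of $S$, plus the fixed constant if that set has no constant. Subformulas: $A$; components of binary-connective subformulas; $B(t)$ for any substitutable term $t$ if $\forall xB(x)$ or $\exists xB(x)$ is a subformula. The closure $\overline S$ = the formulas all of whose parameters lie in $\mathrm{Pars}^*(S)$ that are subformulas of formulas in $S$. Let $P=\mathrm{Pars}^*(S)$. A standard structure for $S$ is a first-order structure with universe $P$, whose individual constants are exactly the elements $p\in P$ (free variables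 included), each interpreted as itself, and whose relation symbols are exactly those occurring in $S$. An override function $O$ for $S$ assigns a value in $\{\top,\bot\}$ to each formula of $\overline S$ of the form $A\lor B$ or $A\to B$ with $A\ne B$, or $\forall xA(x)$ or $\exists xA(x)$ where $x$ occurs free in $A(x)$. For $X\in\overline S$, $M\models_O X$ is defined by induction: atomic $X$: $M$ satisfies $X$ classically ($\top$ holds, $\bot$ fails); $M\models_O A\land B$ iff both; $M\models_O A\lor A$ iff $M\models_O A$, and for $A\ne B$, $M\models_O A\lor B$ iff $M\models_O A$ or $M\models_O B$ or $O(A\lor B)=\top$; $M\models_O A\to A$ always, and for $A\ne B$, $M\models_O A\to B$ iff $M\models_O B$ or ($M\not\models_O A$ and $O(A\to B)=\top$); if $x$ is not free in $A$, $M\models_O \forall xA$ iff $M\models_O A$, otherwise $M\models_O\forall xA(x)$ iff $M\models_O A(t)$ for all $t\in P$ and $O(\forall xA(x))=\top$; if $x$ is not free in $A$, $M\models_O\exists xA$ iff $M\models_O A$, otherwise $M\models_O \exists xA(x)$ iff $M\models_O A(p)$ for some $p\in P$ or $O(\exists xA(x))=\top$. *)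

theory Defs
  imports Main
begin

datatype 'c tm = Var nat | Const 'c

datatype ('c, 'r) fm =
    Top
  | Bot
  | Rel 'r "'c tm list"
  | Conj "('c, 'r) fm" "('c, 'r) fm"
  | Disj "('c, 'r) fm" "('c, 'r) fm"
  | Imp "('c, 'r) fm" "('c, 'r) fm"
  | Forall nat "('c, 'r) fm"
  | Exists nat "('c, 'r) fm"

text \<open>
  A language is given by the type of its constants and by a partial map from relation
  symbols to arities.  The formulas of the language are the elements of the datatype
  that satisfy \<open>wff\<close>.
\<close>

primrec wff :: "('r \<rightharpoonup> nat) \<Rightarrow> ('c, 'r) fm \<Rightarrow> bool" where
  "wff sig Top \<longleftrightarrow> True"
| "wff sig Bot \<longleftrightarrow> True"
| "wff sig (Rel R ts) \<longleftrightarrow> sig R = Some (length ts)"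
| "wff sig (Conj A B) \<longleftrightarrow> wff sig A \<and> wff sig B"
| "wff sig (Disj A B) \<longleftrightarrow> wff sig A \<and> wff sig B"
| "wff sig (Imp A B) \<longleftrightarrow> wff sig A \<and> wff sig B"
| "wff sig (Forall x A) \<longleftrightarrow> wff sig A"
| "wff sig (Exists x A) \<longleftrightarrow> wff sig A"

text \<open>
  Parameters are represented as terms: the constants occurring in a formula and the
  variables free in it.
\<close>

primrec pars :: "('c, 'r) fm \<Rightarrow> 'c tm set" where
  "pars Top = {}"
| "pars Bot = {}"
| "pars (Rel R ts) = set ts"
| "pars (Conj A B) = pars A \<union> pars B"
| "pars (Disj A B) = pars A \<union> pars B"
| "pars (Imp A B) = pars A \<union> pars B"
| "pars (Forall x A) = pars A - {Var x}"
| "pars (Exists x A) = pars A - {Var x}"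

definition free_in :: "nat \<Rightarrow> ('c, 'r) fm \<Rightarrow> bool" where
  "free_in x A \<longleftrightarrow> Var x \<in> pars A"

primrec rels :: "('c, 'r) fm \<Rightarrow> 'r set" where
  "rels Top = {}"
| "rels Bot = {}"
| "rels (Rel R ts) = {R}"
| "rels (Conj A B) = rels A \<union> rels B"
| "rels (Disj A B) = rels A \<union> rels B"
| "rels (Imp A B) = rels A \<union> rels B"
| "rels (Forall x A) = rels A"
| "rels (Exists x A) = rels A"

text \<open>
  \<open>subst x t A\<close> replaces the free occurrences of \<open>x\<close> in \<open>A\<close> by \<open>t\<close> without renaming
  bound variables, so it is only meaningful under \<open>substitutable x t A\<close>, that is, when no
  free occurrence of \<open>x\<close> lies in the scope of a quantifier that would capture \<open>t\<close>.
\<close>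

primrec subst :: "nat \<Rightarrow> 'c tm \<Rightarrow> ('c, 'r) fm \<Rightarrow> ('c, 'r) fm" where
  "subst x t Top = Top"
| "subst x t Bot = Bot"
| "subst x t (Rel R ts) = Rel R (map (\<lambda>s. if s = Var x then t else s) ts)"
| "subst x t (Conj A B) = Conj (subst x t A) (subst x t B)"
| "subst x t (Disj A B) = Disj (subst x t A) (subst x t B)"
| "subst x t (Imp A B) = Imp (subst x t A) (subst x t B)"
| "subst x t (Forall y A) = Forall y (if y = x then A else subst x t A)"
| "subst x t (Exists y A) = Exists y (if y = x then A else subst x t A)"

primrec substitutable :: "nat \<Rightarrow> 'c tm \<Rightarrow> ('c, 'r) fm \<Rightarrow> bool" where
  "substitutable x t Top \<longleftrightarrow> True"
| "substitutable x t Bot \<longleftrightarrow> True"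
| "substitutable x t (Rel R ts) \<longleftrightarrow> True"
| "substitutable x t (Conj A B) \<longleftrightarrow> substitutable x t A \<and> substitutable x t B"
| "substitutable x t (Disj A B) \<longleftrightarrow> substitutable x t A \<and> substitutable x t B"
| "substitutable x t (Imp A B) \<longleftrightarrow> substitutable x t A \<and> substitutable x t B"
| "substitutable x t (Forall y A) \<longleftrightarrow>
     \<not> free_in x (Forall y A) \<or> (t \<noteq> Var y \<and> substitutable x t A)"
| "substitutable x t (Exists y A) \<longleftrightarrow>
     \<not> free_in x (Exists y A) \<or> (t \<noteq> Var y \<and> substitutable x t A)"

text \<open>
  The side conditions \<open>wff sig _\<close> restrict derivations to formulas of the language; they
  are only needed where a rule introduces a formula that is not part of its premises.
\<close>

inductive derivable :: "('r \<rightharpoonup> nat) \<Rightarrow> ('c, 'r) fm set \<Rightarrow> ('c, 'r) fm \<Rightarrow> bool"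
  for sig :: "'r \<rightharpoonup> nat" and H :: "('c, 'r) fm set" where
  hyp: "A \<in> H \<Longrightarrow> derivable sig H A"
| top: "derivable sig H Top"
| imp_refl: "wff sig A \<Longrightarrow> derivable sig H (Imp A A)"
| conjI: "derivable sig H A \<Longrightarrow> derivable sig H B \<Longrightarrow> derivable sig H (Conj A B)"
| conjE1: "derivable sig H (Conj A B) \<Longrightarrow> derivable sig H A"
| conjE2: "derivable sig H (Conj A B) \<Longrightarrow> derivable sig H B"
| disjI1: "derivable sig H A \<Longrightarrow> wff sig B \<Longrightarrow> derivable sig H (Disj A B)"
| disjI2: "derivable sig H B \<Longrightarrow> wff sig A \<Longrightarrow> derivable sig H (Disj A B)"
| disjE: "derivable sig H (Disj A A) \<Longrightarrow> derivable sig H A"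
| impI: "derivable sig H B \<Longrightarrow> wff sig A \<Longrightarrow> derivable sig H (Imp A B)"
| mp: "derivable sig H A \<Longrightarrow> derivable sig H (Imp A B) \<Longrightarrow> derivable sig H B"
| botE: "derivable sig H Bot \<Longrightarrow> wff sig A \<Longrightarrow> derivable sig H A"
| forallI: "derivable sig H A \<Longrightarrow> \<not> free_in x A \<Longrightarrow> derivable sig H (Forall x A)"
| forallE: "derivable sig H (Forall x A) \<Longrightarrow> substitutable x t A \<Longrightarrow>
    derivable sig H (subst x t A)"
| existsI: "derivable sig H (subst x t A) \<Longrightarrow> substitutable x t A \<Longrightarrow>
    derivable sig H (Exists x A)"
| existsE: "derivable sig H (Exists x A) \<Longrightarrow> \<not> free_in x A \<Longrightarrow> derivable sig H A"

definition Pars_star :: "'c \<Rightarrow> ('c, 'r) fm set \<Rightarrow> 'c tm set" where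
  "Pars_star c0 S =
     (\<Union>A\<in>S. pars A) \<union> (if \<exists>c. Const c \<in> (\<Union>A\<in>S. pars A) then {} else {Const c0})"

inductive_set subformulas :: "('c, 'r) fm \<Rightarrow> ('c, 'r) fm set"
  for A :: "('c, 'r) fm" where
  self: "A \<in> subformulas A"
| conj1: "Conj B C \<in> subformulas A \<Longrightarrow> B \<in> subformulas A"
| conj2: "Conj B C \<in> subformulas A \<Longrightarrow> C \<in> subformulas A"
| disj1: "Disj B C \<in> subformulas A \<Longrightarrow> B \<in> subformulas A"
| disj2: "Disj B C \<in> subformulas A \<Longrightarrow> C \<in> subformulas A"
| imp1: "Imp B C \<in> subformulas A \<Longrightarrow> B \<in> subformulas A"
| imp2: "Imp B C \<in> subformulas A \<Longrightarrow> C \<in> subformulas A"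
| forall: "Forall x B \<in> subformulas A \<Longrightarrow> substitutable x t B \<Longrightarrow> subst x t B \<in> subformulas A"
| exists: "Exists x B \<in> subformulas A \<Longrightarrow> substitutable x t B \<Longrightarrow> subst x t B \<in> subformulas A"

definition closure :: "'c \<Rightarrow> ('c, 'r) fm set \<Rightarrow> ('c, 'r) fm set" where
  "closure c0 S = {X. pars X \<subseteq> Pars_star c0 S \<and> (\<exists>A\<in>S. X \<in> subformulas A)}"

text \<open>
  First-order structures for a relational language with individual constants \<open>'k\<close> and
  relation symbols \<open>'r\<close>; the domains of the two partial maps are the sets of symbols
  that the structure interprets.
\<close>

record ('k, 'r, 'u) struct =
  universe :: "'u set"
  const_interp :: "'k \<rightharpoonup> 'u"
  rel_interp :: "'r \<rightharpoonup> 'u list set"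

definition standard_structure ::
  "('r \<rightharpoonup> nat) \<Rightarrow> 'c \<Rightarrow> ('c, 'r) fm set \<Rightarrow> ('c tm, 'r, 'c tm) struct \<Rightarrow> bool" where
  "standard_structure sig c0 S M \<longleftrightarrow>
     universe M = Pars_star c0 S \<and>
     dom (const_interp M) = Pars_star c0 S \<and>
     (\<forall>p\<in>Pars_star c0 S. const_interp M p = Some p) \<and>
     dom (rel_interp M) = (\<Union>A\<in>S. rels A) \<and>
     (\<forall>R I. rel_interp M R = Some I \<longrightarrow>
        (\<forall>us\<in>I. set us \<subseteq> universe M \<and> sig R = Some (length us)))"

definition overridable :: "('c, 'r) fm \<Rightarrow> bool" where
  "overridable X \<longleftrightarrow>
     (\<exists>A B. A \<noteq> B \<and> (X = Disj A B \<or> X = Imp A B)) \<or>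
     (\<exists>x A. free_in x A \<and> (X = Forall x A \<or> X = Exists x A))"

definition override_function ::
  "'c \<Rightarrow> ('c, 'r) fm set \<Rightarrow> (('c, 'r) fm \<rightharpoonup> bool) \<Rightarrow> bool" where
  "override_function c0 S Ov \<longleftrightarrow> dom Ov = {X \<in> closure c0 S. overridable X}"

primrec connectives :: "('c, 'r) fm \<Rightarrow> nat" where
  "connectives Top = 0"
| "connectives Bot = 0"
| "connectives (Rel R ts) = 0"
| "connectives (Conj A B) = Suc (connectives A + connectives B)"
| "connectives (Disj A B) = Suc (connectives A + connectives B)"
| "connectives (Imp A B) = Suc (connectives A + connectives B)"
| "connectives (Forall x A) = Suc (connectives A)"
| "connectives (Exists x A) = Suc (connectives A)"

lemma connectives_subst [simp]: "connectives (subst x t A) = connectives A"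
  by (induction A) auto

text \<open>
  The relation is only meaningful for formulas in \<open>closure c0 S\<close>, a set that the recursion
  does not leave when \<open>M\<close> is a standard structure for \<open>S\<close>.  Instances are only taken at
  substitutable elements of the universe; other instances are not defined.
\<close>

function (sequential) sat ::
  "('c tm, 'r, 'c tm) struct \<Rightarrow> (('c, 'r) fm \<rightharpoonup> bool) \<Rightarrow> ('c, 'r) fm \<Rightarrow> bool" where
  "sat M Ov Top \<longleftrightarrow> True"
| "sat M Ov Bot \<longleftrightarrow> False"
| "sat M Ov (Rel R ts) \<longleftrightarrow> map (\<lambda>t. the (const_interp M t)) ts \<in> the (rel_interp M R)"
| "sat M Ov (Conj A B) \<longleftrightarrow> sat M Ov A \<and> sat M Ov B"
| "sat M Ov (Disj A B) \<longleftrightarrow>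
     (if A = B then sat M Ov A
      else sat M Ov A \<or> sat M Ov B \<or> Ov (Disj A B) = Some True)"
| "sat M Ov (Imp A B) \<longleftrightarrow>
     (if A = B then True
      else sat M Ov B \<or> (\<not> sat M Ov A \<and> Ov (Imp A B) = Some True))"
| "sat M Ov (Forall x A) \<longleftrightarrow>
     (if \<not> free_in x A then sat M Ov A
      else (\<forall>t\<in>universe M. substitutable x t A \<longrightarrow> sat M Ov (subst x t A)) \<and>
           Ov (Forall x A) = Some True)"
| "sat M Ov (Exists x A) \<longleftrightarrow>
     (if \<not> free_in x A then sat M Ov A
      else (\<exists>t\<in>universe M. substitutable x t A \<and> sat M Ov (subst x t A)) \<or>
           Ov (Exists x A) = Some True)"
  by pat_completeness auto
termination
  by (relation "measure (\<lambda>(M, Ov, X). connectives X)") auto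

end

theory Submission
  imports Defs
begin

text \<open>
  Take the structure whose true atoms are the derivable ones, and let the override function
  be derivability itself. Each clause of \<open>sat\<close> is then matched by the rules for that
  connective, so on the closure of \<open>S\<close> satisfaction coincides with derivability.
\<close>

lemma subst_not_free: "\<not> free_in x A \<Longrightarrow> subst x t A = A"
  by (induction A) (auto simp: free_in_def intro: map_idI)

lemma substitutable_not_free: "\<not> free_in x A \<Longrightarrow> substitutable x t A"
  by (induction A) (auto simp: free_in_def)

text \<open>Equality can fail, since \<open>t\<close> does not enter when \<open>x\<close> is not
  free and may be captured by a quantifier. The inclusion suffices to keep instances at elements of
  \<open>Pars_star\<close> inside the closure.\<close>

lemma pars_subst: "pars (subst x t A) \<subseteq> insert t (pars A - {Var x})"
  by (induction A) (auto split: if_splits)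

lemma wff_subst [simp]: "wff sig (subst x t A) \<longleftrightarrow> wff sig A"
  by (induction A) auto

lemma rels_subst [simp]: "rels (subst x t A) = rels A"
  by (induction A) auto

lemma wff_subformulas: "X \<in> subformulas A \<Longrightarrow> wff sig A \<Longrightarrow> wff sig X"
  by (induction rule: subformulas.induct) auto

lemma rels_subformulas: "X \<in> subformulas A \<Longrightarrow> rels X \<subseteq> rels A"
  by (induction rule: subformulas.induct) auto

lemma closure_Conj: "Conj A B \<in> closure c0 S \<Longrightarrow> A \<in> closure c0 S \<and> B \<in> closure c0 S"
  unfolding closure_def by (auto intro: subformulas.conj1 subformulas.conj2)

lemma closure_Disj: "Disj A B \<in> closure c0 S \<Longrightarrow> A \<in> closure c0 S \<and> B \<in> closure c0 S"
  unfolding closure_def by (auto intro: subformulas.disj1 subformulas.disj2)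

lemma closure_Imp: "Imp A B \<in> closure c0 S \<Longrightarrow> A \<in> closure c0 S \<and> B \<in> closure c0 S"
  unfolding closure_def by (auto intro: subformulas.imp1 subformulas.imp2)

lemma closure_instance:
  assumes "Forall x A \<in> closure c0 S \<or> Exists x A \<in> closure c0 S"
    and "substitutable x t A" and "t \<in> Pars_star c0 S"
  shows "subst x t A \<in> closure c0 S"
  using assms pars_subst[of x t A] unfolding closure_def
  by (auto intro: subformulas.forall subformulas.exists)

lemma closure_vacuous:
  assumes "Forall x A \<in> closure c0 S \<or> Exists x A \<in> closure c0 S" and "\<not> free_in x A"
  shows "A \<in> closure c0 S"
proof -
  have "pars A \<subseteq> Pars_star c0 S"
    using assms by (auto simp: closure_def free_in_def)
  \<comment> \<open>\<open>subformulas\<close> yields only instances of a quantified body. Since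
    \<open>x\<close> is not free, the instance at \<open>Var x\<close> is the body itself, even if
    \<open>Var x\<close> lies outside \<open>Pars_star\<close>.\<close>
  moreover have "\<exists>B\<in>S. subst x (Var x) A \<in> subformulas B"
    using assms(1) substitutable_not_free[OF assms(2)] unfolding closure_def
    by (auto intro: subformulas.forall subformulas.exists)
  ultimately show ?thesis
    by (simp add: closure_def subst_not_free[OF assms(2)])
qed

lemma subset_closure: "S \<subseteq> closure c0 S"
  unfolding closure_def Pars_star_def by (auto intro: subformulas.self)

lemma derivable_Conj:
  "derivable sig H (Conj A B) \<longleftrightarrow> derivable sig H A \<and> derivable sig H B"
  by (metis derivable.conjI derivable.conjE1 derivable.conjE2)

lemma derivable_Disj_same:
  "wff sig A \<Longrightarrow> derivable sig H (Disj A A) \<longleftrightarrow> derivable sig H A"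
  by (metis derivable.disjI1 derivable.disjE)

text \<open>When \<open>x\<close> is not free, every instance of \<open>A\<close> is
  \<open>A\<close>, so \<open>forallE\<close> inverts \<open>forallI\<close>.\<close>

lemma derivable_Forall_vacuous:
  "\<not> free_in x A \<Longrightarrow> derivable sig H (Forall x A) \<longleftrightarrow> derivable sig H A"
  by (metis derivable.forallE derivable.forallI subst_not_free substitutable_not_free)

lemma derivable_Exists_vacuous:
  "\<not> free_in x A \<Longrightarrow> derivable sig H (Exists x A) \<longleftrightarrow> derivable sig H A"
  by (metis derivable.existsE derivable.existsI subst_not_free substitutable_not_free)

text \<open>A term model. Derivable atoms may mention terms outside \<open>Pars_star\<close>, as
  \<open>forallE\<close> instantiates at any substitutable term, so the relations are cut down to
  tuples over the universe.\<close>

definition derivability_struct ::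
  "('r \<rightharpoonup> nat) \<Rightarrow> 'c \<Rightarrow> ('c, 'r) fm set \<Rightarrow> ('c, 'r) fm set \<Rightarrow> ('c tm, 'r, 'c tm) struct" where
  "derivability_struct sig c0 S H =
     \<lparr>universe = Pars_star c0 S,
      const_interp = (\<lambda>p. if p \<in> Pars_star c0 S then Some p else None),
      rel_interp = (\<lambda>R. if R \<in> (\<Union>A\<in>S. rels A)
        then Some {ts. set ts \<subseteq> Pars_star c0 S \<and> sig R = Some (length ts) \<and>
                       derivable sig H (Rel R ts)}
        else None)\<rparr>"

definition derivability_override ::
  "('r \<rightharpoonup> nat) \<Rightarrow> 'c \<Rightarrow> ('c, 'r) fm set \<Rightarrow> ('c, 'r) fm set \<Rightarrow> ('c, 'r) fm \<rightharpoonup> bool" where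
  "derivability_override sig c0 S H =
     (\<lambda>X. if X \<in> closure c0 S \<and> overridable X then Some (derivable sig H X) else None)"

lemma standard_derivability_struct:
  "standard_structure sig c0 S (derivability_struct sig c0 S H)"
  unfolding standard_structure_def derivability_struct_def
  by (auto simp: dom_def split: if_splits)

lemma override_derivability_override:
  "override_function c0 S (derivability_override sig c0 S H)"
  unfolding override_function_def derivability_override_def by (auto simp: dom_def)

text \<open>The override supplies what the components leave open: a disjunction, for instance, may
  be derivable with neither disjunct derivable.\<close>

lemma sat_iff_derivable:
  assumes wff: "\<forall>A\<in>S. wff sig A" and consistent: "\<not> derivable sig H Bot"
    and "X \<in> closure c0 S"
  shows "sat (derivability_struct sig c0 S H) (derivability_override sig c0 S H) X
           \<longleftrightarrow> derivable sig H X"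
    (is "sat ?M ?O X \<longleftrightarrow> _")
  using assms(3)
\<comment> \<open>Structural induction would not reach the instances \<open>subst x t A\<close>,
  whereas substitution preserves the number of connectives.\<close>
proof (induction X rule: measure_induct_rule[of connectives])
  case (less X)
  \<comment> \<open>This discharges the side conditions of \<open>imp_refl\<close>,
    \<open>disjI1\<close>, \<open>disjI2\<close> and \<open>impI\<close>.\<close>
  have wffC: "wff sig Y" if "Y \<in> closure c0 S" for Y
    using that wff wff_subformulas unfolding closure_def by blast
  have ov: "?O X = Some True \<longleftrightarrow> derivable sig H X" if "overridable X"
    using that less.prems by (simp add: derivability_override_def)
  have univ: "universe ?M = Pars_star c0 S"
    by (simp add: derivability_struct_def)
  show ?case
  proof (cases X)
    case Top
    then show ?thesis by (simp add: derivable.top)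
  next
    case Bot
    then show ?thesis using consistent by simp
  next
    case (Rel R ts)
    have ts: "set ts \<subseteq> Pars_star c0 S"
      using less.prems Rel by (simp add: closure_def)
    \<comment> \<open>Hence \<open>rel_interp\<close> is defined at \<open>R\<close>, and
      \<open>the\<close> returns the intended relation.\<close>
    have "R \<in> (\<Union>A\<in>S. rels A)"
      using less.prems Rel rels_subformulas unfolding closure_def by fastforce
    moreover have "map (\<lambda>t. the (const_interp ?M t)) ts = ts"
      using ts by (auto simp: derivability_struct_def intro!: map_idI)
    ultimately show ?thesis
      using Rel ts wffC[OF less.prems] by (simp add: derivability_struct_def)
  next
    case (Conj A B)
    have "sat ?M ?O A \<longleftrightarrow> derivable sig H A" "sat ?M ?O B \<longleftrightarrow> derivable sig H B"
      using less closure_Conj[of A B c0 S] Conj by auto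
    then show ?thesis
      using Conj by (simp add: derivable_Conj)
  next
    case (Disj A B)
    have cl: "A \<in> closure c0 S" "B \<in> closure c0 S"
      using less.prems closure_Disj[of A B c0 S] Disj by simp_all
    have IH: "sat ?M ?O A \<longleftrightarrow> derivable sig H A" "sat ?M ?O B \<longleftrightarrow> derivable sig H B"
      using less.IH cl Disj by auto
    show ?thesis
    proof (cases "A = B")
      case True
      then show ?thesis
        using Disj IH wffC[OF cl(1)] by (simp add: derivable_Disj_same)
    next
      case False
      then have "overridable X" using Disj by (auto simp: overridable_def)
      then show ?thesis
        using False Disj IH wffC[OF cl(1)] wffC[OF cl(2)] ov
          derivable.disjI1[of sig H A B] derivable.disjI2[of sig H B A]
        by auto
    qed
  next
    case (Imp A B)
    have cl: "A \<in> closure c0 S" "B \<in> closure c0 S"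
      using less.prems closure_Imp[of A B c0 S] Imp by simp_all
    have IH: "sat ?M ?O A \<longleftrightarrow> derivable sig H A" "sat ?M ?O B \<longleftrightarrow> derivable sig H B"
      using less.IH cl Imp by auto
    show ?thesis
    proof (cases "A = B")
      case True
      then show ?thesis
        using Imp wffC[OF cl(1)] by (simp add: derivable.imp_refl)
    next
      case False
      then have "overridable X" using Imp by (auto simp: overridable_def)
      then show ?thesis
        \<comment> \<open>If the implication is derivable, then either \<open>A\<close> is derivable
          and \<open>mp\<close> gives \<open>B\<close>, or \<open>A\<close> fails and the override
          makes the implication true.\<close>
        using False Imp IH wffC[OF cl(1)] ov derivable.impI[of sig H B A] derivable.mp[of sig H A B]
        by auto
    qed
  next
    case (Forall x A)
    show ?thesis
    proof (cases "free_in x A")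
      case True
      then have "overridable X" using Forall by (auto simp: overridable_def)
      moreover have "sat ?M ?O (subst x t A) \<longleftrightarrow> derivable sig H (subst x t A)"
        if "t \<in> Pars_star c0 S" "substitutable x t A" for t
        using that less closure_instance[of x A c0 S t] Forall by simp
      ultimately show ?thesis
        \<comment> \<open>The override conjunct alone gives derivability; conversely
          \<open>forallE\<close> yields all the instances.\<close>
        using True Forall ov univ derivable.forallE[of sig H x A] by auto
    next
      case False
      then have "A \<in> closure c0 S" using less.prems Forall closure_vacuous[of x A c0 S] by simp
      then show ?thesis
        using False Forall less.IH derivable_Forall_vacuous[OF False] by simp
    qed
  next
    case (Exists x A)
    show ?thesis
    proof (cases "free_in x A")
      case True
      then have "overridable X" using Exists by (auto simp: overridable_def)
      moreover have "sat ?M ?O (subst x t A) \<longleftrightarrow> derivable sig H (subst x t A)"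
        if "t \<in> Pars_star c0 S" "substitutable x t A" for t
        using that less closure_instance[of x A c0 S t] Exists by simp
      ultimately show ?thesis
        \<comment> \<open>Dually, a true instance gives derivability by \<open>existsI\<close>, and
          a derivable existential without a true instance holds by the override.\<close>
        using True Exists ov univ derivable.existsI[of sig H x _ A] by auto
    next
      case False
      then have "A \<in> closure c0 S" using less.prems Exists closure_vacuous[of x A c0 S] by simp
      then show ?thesis
        using False Exists less.IH derivable_Exists_vacuous[OF False] by simp
    qed
  qed
qed

theorem theorem7p5:
  fixes sig :: "'r \<rightharpoonup> nat"
    and c0 :: 'c
    and H :: "('c, 'r) fm set"
    and Q :: "('c, 'r) fm"
    and S :: "('c, 'r) fm set"
  assumes "\<forall>A\<in>H. wff sig A"
    and "wff sig Q"
    and "\<not> derivable sig H Q"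
    and "S = H \<union> {Q}"
  shows "\<exists>(M :: ('c tm, 'r, 'c tm) struct) (Ov :: ('c, 'r) fm \<rightharpoonup> bool).
           standard_structure sig c0 S M \<and> override_function c0 S Ov \<and>
           (\<forall>Y\<in>H. sat M Ov Y) \<and> \<not> sat M Ov Q"
proof -
  let ?M = "derivability_struct sig c0 S H" and ?O = "derivability_override sig c0 S H"
  \<comment> \<open>Otherwise \<open>botE\<close> would derive \<open>Q\<close>.\<close>
  have "\<not> derivable sig H Bot"
    using assms(2,3) derivable.botE by blast
  then have sat: "sat ?M ?O X \<longleftrightarrow> derivable sig H X" if "X \<in> S" for X
    using that assms(1,2,4) subset_closure[of S c0] by (intro sat_iff_derivable) auto
  then have "(\<forall>Y\<in>H. sat ?M ?O Y) \<and> \<not> sat ?M ?O Q"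
    using assms(3,4) by (auto intro: derivable.hyp)
  then show ?thesis
    using standard_derivability_struct[of sig c0 S H]
      override_derivability_override[of c0 S sig H] by blast
qed

end
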